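(* Let $X$ be a real or complex Banach space, let $1<p<\infty$ and $\frac1p+\frac1q=1$. Let $(x_i)\in S(\ell^p(X))$ with $x_i\neq 0$ for each $i\in\mathbb{N}$, and let $(x_i^* )\in S_{(x_i)}\subseteq \ell^q(X^* )=\ell^p(X)^*$. Then the identity map $I:(S_{(x_i)},\mathrm{w}^* )\to(S_{(x_i)},\|\cdot\|)$ is continuous at $(x_i^* )$ if and only if for each $i\in\mathbb{N}$ the functional $\frac{x_i^*}{\|x_i^*\|}\in S_{\frac{x_i}{\|x_i\|}}$ is a w$^*$-$\|\cdot\|$ PC of $S_{\frac{x_i}{\|x_i\|}}$.
   Context: For a Banach space $E$, $S(E)$ is its unit sphere. For $x\in S(E)$ the state space of $x$ is $S_x=\{x^*\in S(E^* ): x^*(x)=1\}$. For $K$ a norm closed bounded subset of the unit ball of $E^*$, a point $x^*\in K$ is a w$^*$-$\|\cdot\|$ PC (also called w$^*$-PC) of $K$ if the identity map $I:(K,\mathrm{w}^* )\to(K,\|\cdot\|)$ is continuous at $x^*$, where w$^*$ is the (relative) weak$^*$ topology and $\|\cdot\|$ the norm topology. $\ell^p(X)=\{(x_i)_{i\in\mathbb{N}}: x_i\in X,\ \sum_i\|x_i\|^p<\infty\}$ with norm $\|(x_i)\|=(\sum_i\|x_i\|^p)^{1/p}$; its dual is identified with $\ell^q(X^* )$ via $(x_i^* )((x_i))=\sum_i x_i^*(x_i)$. *)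

theory Defs
  imports "HOL-Analysis.Analysis" "HOL-Library.Function_Algebras"
begin

text \<open>
  Scalar fields: up to isometric field isomorphism, exactly the reals and the complex numbers.
\<close>

class real_or_complex = real_normed_field +
  assumes real_or_complex_embedding:
    "\<exists>h :: 'a \<Rightarrow> complex.
       (\<forall>a b. h (a + b) = h a + h b \<and> h (a * b) = h a * h b) \<and>
       (\<forall>a. norm (h a) = norm a) \<and>
       (range h = \<real> \<or> range h = UNIV)"

instance real :: real_or_complex
  by standard (rule exI[of _ complex_of_real], auto simp: Reals_def)

instance complex :: real_or_complex
  by standard (rule exI[of _ "\<lambda>z. z"], auto)

text \<open>
  Normed spaces over a scalar field are given by a carrier inside an additive group, because
  the sequence space \<open>\<ell>\<^sup>p(X)\<close> depends on the real number \<open>p\<close> and so cannot be a type. The addition is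
  that of the ambient group; on function types it is the pointwise one.
\<close>

record ('k, 'e) nspace =
  vecs :: "'e set"
  scl :: "'k \<Rightarrow> 'e \<Rightarrow> 'e"
  nrm :: "'e \<Rightarrow> real"

definition ndist :: "('k, 'e::ab_group_add) nspace \<Rightarrow> 'e \<Rightarrow> 'e \<Rightarrow> real" where
  \<comment> \<open>The value off the carrier is irrelevant; 0 makes it a metric in the sense of \<open>Metric_space\<close>.\<close>
  "ndist E x y = (if x \<in> vecs E \<and> y \<in> vecs E then nrm E (x - y) else 0)"

locale normed_space =
  fixes E :: "('k::real_or_complex, 'e::ab_group_add) nspace"
  assumes zero_mem: "0 \<in> vecs E"
    and add_mem: "x \<in> vecs E \<Longrightarrow> y \<in> vecs E \<Longrightarrow> x + y \<in> vecs E"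
    and scl_mem: "x \<in> vecs E \<Longrightarrow> scl E a x \<in> vecs E"
    and scl_add_right: "x \<in> vecs E \<Longrightarrow> y \<in> vecs E \<Longrightarrow> scl E a (x + y) = scl E a x + scl E a y"
    and scl_add_left: "x \<in> vecs E \<Longrightarrow> scl E (a + b) x = scl E a x + scl E b x"
    and scl_scl: "x \<in> vecs E \<Longrightarrow> scl E a (scl E b x) = scl E (a * b) x"
    and scl_one: "x \<in> vecs E \<Longrightarrow> scl E 1 x = x"
    and nrm_eq_0_iff: "x \<in> vecs E \<Longrightarrow> nrm E x = 0 \<longleftrightarrow> x = 0"
    and nrm_scl: "x \<in> vecs E \<Longrightarrow> nrm E (scl E a x) = norm a * nrm E x"
    and nrm_triangle: "x \<in> vecs E \<Longrightarrow> y \<in> vecs E \<Longrightarrow> nrm E (x + y) \<le> nrm E x + nrm E y"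
begin

lemma scl_zero_left: "x \<in> vecs E \<Longrightarrow> scl E 0 x = 0"
  using scl_add_left[of x 0 0] by simp

lemma scl_minus_one:
  assumes "x \<in> vecs E"
  shows "scl E (- 1) x = - x"
proof -
  have "scl E (- 1) x + x = 0"
    using scl_add_left[OF assms, of "- 1" 1] scl_zero_left[OF assms] scl_one[OF assms] by simp
  then show ?thesis
    by (simp add: add_eq_0_iff2)
qed

lemma minus_mem: "x \<in> vecs E \<Longrightarrow> - x \<in> vecs E"
  using scl_mem[of x "- 1"] scl_minus_one by simp

lemma diff_mem: "x \<in> vecs E \<Longrightarrow> y \<in> vecs E \<Longrightarrow> x - y \<in> vecs E"
  using add_mem[of x "- y"] minus_mem by simp

lemma nrm_minus: "x \<in> vecs E \<Longrightarrow> nrm E (- x) = nrm E x"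
  using nrm_scl[of x "- 1"] scl_minus_one by simp

lemma nrm_nonneg:
  assumes "x \<in> vecs E"
  shows "0 \<le> nrm E x"
  using nrm_triangle[OF assms minus_mem[OF assms]] nrm_minus[OF assms]
    nrm_eq_0_iff[OF zero_mem] by simp

lemma Metric_space_ndist: "Metric_space (vecs E) (ndist E)"
proof
  fix x y z
  show "0 \<le> ndist E x y"
    by (simp add: ndist_def diff_mem nrm_nonneg)
  show "ndist E x y = ndist E y x"
    using nrm_minus[OF diff_mem, of x y] by (simp add: ndist_def)
  assume xy: "x \<in> vecs E" "y \<in> vecs E"
  then show "ndist E x y = 0 \<longleftrightarrow> x = y"
    by (simp add: ndist_def nrm_eq_0_iff diff_mem)
  assume "z \<in> vecs E"
  then show "ndist E x z \<le> ndist E x y + ndist E y z"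
    using xy nrm_triangle[OF diff_mem diff_mem, of x y y z] by (simp add: ndist_def)
qed

end

locale banach_space = normed_space +
  assumes complete: "Metric_space.mcomplete (vecs E) (ndist E)"

definition norm_topology :: "('k, 'e::ab_group_add) nspace \<Rightarrow> 'e topology" where
  "norm_topology E = Metric_space.mtopology (vecs E) (ndist E)"

definition unit_sphere :: "('k, 'e) nspace \<Rightarrow> 'e set" where
  "unit_sphere E = {x \<in> vecs E. nrm E x = 1}"

definition normed_vec :: "('k::real_normed_field, 'e) nspace \<Rightarrow> 'e \<Rightarrow> 'e" where
  "normed_vec E x = scl E (of_real (1 / nrm E x)) x"

text \<open>
  The dual space: bounded linear functionals on the carrier with the operator norm. Functionals
  are extended by 0 off the carrier, so that equal functionals are equal as HOL functions and
  the pointwise operations preserve the dual.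
\<close>

definition dual :: "('k::real_normed_field, 'e::ab_group_add) nspace \<Rightarrow> ('k, 'e \<Rightarrow> 'k) nspace" where
  "dual E = \<lparr>
     vecs = {f. (\<forall>x. x \<notin> vecs E \<longrightarrow> f x = 0) \<and>
                (\<forall>x\<in>vecs E. \<forall>y\<in>vecs E. f (x + y) = f x + f y) \<and>
                (\<forall>a. \<forall>x\<in>vecs E. f (scl E a x) = a * f x) \<and>
                (\<exists>B. \<forall>x\<in>vecs E. norm (f x) \<le> B * nrm E x)},
     scl = (\<lambda>a f x. a * f x),
     nrm = (\<lambda>f. SUP x\<in>{x \<in> vecs E. nrm E x \<le> 1}. norm (f x)) \<rparr>"

text \<open>The initial topology on the dual for the evaluations at the points of \<open>E\<close>:\<close>

definition weak_star :: "('k::real_normed_field, 'e::ab_group_add) nspace \<Rightarrow> ('e \<Rightarrow> 'k) topology" where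
  "weak_star E = pullback_topology (vecs (dual E)) (\<lambda>f. restrict f (vecs E))
     (product_topology (\<lambda>x. euclidean) (vecs E))"

definition state_space :: "('k::real_normed_field, 'e::ab_group_add) nspace \<Rightarrow> 'e \<Rightarrow> ('e \<Rightarrow> 'k) set" where
  "state_space E x = {f \<in> unit_sphere (dual E). f x = 1}"

definition wstar_norm_PC ::
    "('k::real_normed_field, 'e::ab_group_add) nspace \<Rightarrow> ('e \<Rightarrow> 'k) set \<Rightarrow> ('e \<Rightarrow> 'k) \<Rightarrow> bool" where
  "wstar_norm_PC E K f \<longleftrightarrow> f \<in> K \<and>
     topcontinuous_at (subtopology (weak_star E) K) (subtopology (norm_topology (dual E)) K)
       (\<lambda>g. g) f"

definition lp :: "real \<Rightarrow> ('k, 'e) nspace \<Rightarrow> ('k, nat \<Rightarrow> 'e) nspace" where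
  "lp p E = \<lparr>
     vecs = {x. (\<forall>i. x i \<in> vecs E) \<and> summable (\<lambda>i. nrm E (x i) powr p)},
     scl = (\<lambda>a x i. scl E a (x i)),
     nrm = (\<lambda>x. (\<Sum>i. nrm E (x i) powr p) powr (1 / p)) \<rparr>"

text \<open>
  The functional on \<open>\<ell>\<^sup>p(E)\<close> given by a sequence of functionals on \<open>E\<close>; for \<open>1 < p\<close> and
  \<open>1/p + 1/q = 1\<close> it realises the identification of \<open>\<ell>\<^sup>q(E\<^sup>*)\<close> with the dual of \<open>\<ell>\<^sup>p(E)\<close>.
\<close>

definition lp_functional ::
    "real \<Rightarrow> ('k::real_normed_field, 'e) nspace \<Rightarrow> (nat \<Rightarrow> 'e \<Rightarrow> 'k) \<Rightarrow> (nat \<Rightarrow> 'e) \<Rightarrow> 'k" where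
  "lp_functional p E f = (\<lambda>x. if x \<in> vecs (lp p E) then (\<Sum>i. f i (x i)) else 0)"

end

theory Submission
  imports Defs
begin

text \<open>
  The state space of a unit vector \<open>x\<close> of \<open>\<ell>\<^sup>p(X)\<close> with all coordinates non-zero is a product of state
  spaces. Write \<open>a\<^sub>i = \<parallel>x\<^sub>i\<parallel>\<close> and \<open>c\<^sub>i = a\<^sub>i\<^sup>p\<^sup>-\<^sup>1\<close>, and let \<open>G\<^sub>i\<close> be the restriction of a bounded functional \<open>G\<close>
  to the \<open>i\<close>-th coordinate, so that \<open>G y = (\<Sum>i. G\<^sub>i y\<^sub>i)\<close> (\<open>dual_lp_sums\<close>). Then \<open>G\<close> is a state of \<open>x\<close> iff
  every \<open>G\<^sub>i / c\<^sub>i\<close> is a state of \<open>x\<^sub>i / a\<^sub>i\<close> (\<open>state_space_lp_iff\<close>). If \<open>G\<close> is a state, its real part is at most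
  the norm, with equality at \<open>x\<close>. Varying the \<open>i\<close>-th coordinate over the ball of radius \<open>a\<^sub>i\<close> does not
  increase the norm, so \<open>G\<^sub>i\<close> attains \<open>\<parallel>G\<^sub>i\<parallel> a\<^sub>i\<close> at \<open>x\<^sub>i\<close>; scaling the \<open>i\<close>-th coordinate and comparing
  derivatives shows that this value is \<open>a\<^sub>i\<^sup>p\<close> (\<open>component_of_state\<close>). Conversely, norms \<open>\<parallel>G\<^sub>i\<parallel> = c\<^sub>i\<close> give
  \<open>\<parallel>G\<parallel> \<le> 1\<close> by Young's inequality, and \<open>G x = (\<Sum>i. a\<^sub>i\<^sup>p) = 1\<close>. In this way the duality between
  \<open>\<ell>\<^sup>p(X)\<close> and \<open>\<ell>\<^sup>q(X\<^sup>*)\<close> enters only through the functionals \<open>G\<^sub>i\<close>.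

  Let \<open>F\<close> be a state of \<open>x\<close> and \<open>h\<^sub>i = F\<^sub>i / c\<^sub>i\<close>. Suppose first that weak-star closeness to \<open>F\<close> forces norm
  closeness among the states of \<open>x\<close>. Replacing the \<open>i\<close>-th component of \<open>F\<close> by \<open>c\<^sub>i h\<close> embeds the states \<open>h\<close> of
  \<open>x\<^sub>i / a\<^sub>i\<close> into those of \<open>x\<close>; the embedding is weak-star continuous and shrinks norm distances at most
  by the factor \<open>c\<^sub>i\<close>, so the property descends to \<open>h\<^sub>i\<close>.

  Suppose now that every \<open>h\<^sub>i\<close> is a point of continuity. The numbers \<open>\<parallel>G\<^sub>i\<parallel> = c\<^sub>i\<close> are the same for
  all states \<open>G\<close>, hence by Young's inequality the tails \<open>\<Sum>i\<ge>n. (G\<^sub>i - F\<^sub>i) y\<^sub>i\<close> are small for large \<open>n\<close>,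
  uniformly in the states \<open>G\<close> and in \<open>y\<close> from the unit ball. Only finitely many coordinates remain,
  and they are controlled by finitely many weak-star open conditions on \<open>G\<close>.
\<close>

section \<open>The real part of a scalar\<close>

text \<open>
  The real part, taken through an embedding into the complex numbers. The embedding fixes each real
  \<open>s\<close>: its image is at distance \<open>\<bar>s\<bar>\<close> from \<open>0\<close> and \<open>\<bar>s - 1\<bar>\<close> from \<open>1\<close>, and the two circles touch in \<open>s\<close>.
\<close>

lemma real_part_functional:
  obtains r :: "'k::real_or_complex \<Rightarrow> real"
  where "\<And>a b. r (a + b) = r a + r b"
    and "\<And>s a. r (of_real s * a) = s * r a"
    and "\<And>a. r a \<le> norm a"
    and "\<And>s. r (of_real s) = s"
    and "\<And>a. r a = norm a \<Longrightarrow> a = of_real (norm a)"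
proof -
  obtain h :: "'k \<Rightarrow> complex" where
    add: "\<And>a b. h (a + b) = h a + h b" and mult: "\<And>a b. h (a * b) = h a * h b"
    and iso: "\<And>a. norm (h a) = norm a"
    using real_or_complex_embedding by blast
  have h1: "h 1 = 1"
  proof -
    have "h 1 * h 1 = h 1" using mult[of 1 1] by simp
    moreover have "h 1 \<noteq> 0" using iso[of 1] by auto
    ultimately show ?thesis by simp
  qed
  have h_diff: "h (a - b) = h a - h b" for a b
    using add[of "a - b" b] by simp
  have h_real: "h (of_real s) = of_real s" for s
  proof -
    have n0: "norm (h (of_real s)) = \<bar>s\<bar>" by (simp add: iso)
    have "h (of_real s) - 1 = h (of_real (s - 1))" by (simp add: h_diff h1)
    then have n1: "norm (h (of_real s) - 1) = \<bar>s - 1\<bar>"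
      by (metis iso norm_of_real)
    let ?z = "h (of_real s)"
    have e0: "(Re ?z)\<^sup>2 + (Im ?z)\<^sup>2 = s\<^sup>2"
      using n0 by (metis cmod_power2 power2_abs)
    have e1: "(Re ?z - 1)\<^sup>2 + (Im ?z)\<^sup>2 = (s - 1)\<^sup>2"
      using n1 cmod_power2[of "?z - 1"] by simp
    have re: "Re ?z = s"
      using e0 e1 by (simp add: power2_eq_square algebra_simps)
    moreover have "Im ?z = 0" using e0 re by simp
    ultimately show ?thesis by (simp add: complex_eq_iff)
  qed
  show thesis
  proof
    fix a b :: 'k and s :: real
    show "Re (h (a + b)) = Re (h a) + Re (h b)" by (simp add: add)
    show "Re (h (of_real s * a)) = s * Re (h a)" by (simp add: mult h_real)
    show "Re (h a) \<le> norm a" using complex_Re_le_cmod[of "h a"] by (simp add: iso)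
    show "Re (h (of_real s)) = s" by (simp add: h_real)
    assume eq: "Re (h a) = norm a"
    then have "Im (h a) = 0"
      using cmod_power2[of "h a"] by (simp add: iso)
    with eq have "h a = of_real (norm a)" by (simp add: complex_eq_iff)
    then have "h (a - of_real (norm a)) = 0" by (simp add: h_diff h_real)
    then show "a = of_real (norm a)"
      using iso[of "a - of_real (norm a)"] by simp
  qed
qed

section \<open>The dual of a normed space\<close>

context normed_space
begin

lemma nrm_zero: "nrm E 0 = 0"
  using nrm_eq_0_iff[OF zero_mem] by simp

lemma nrm_pos: "x \<in> vecs E \<Longrightarrow> x \<noteq> 0 \<Longrightarrow> 0 < nrm E x"
  using nrm_nonneg[of x] nrm_eq_0_iff[of x] by (simp add: order_less_le)

lemma normed_vec_mem: "x \<in> vecs E \<Longrightarrow> normed_vec E x \<in> vecs E"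
  by (simp add: normed_vec_def scl_mem)

lemma nrm_normed_vec: "x \<in> vecs E \<Longrightarrow> x \<noteq> 0 \<Longrightarrow> nrm E (normed_vec E x) = 1"
  using nrm_pos[of x] by (simp add: normed_vec_def nrm_scl norm_divide)

lemma dual_off: "f \<in> vecs (dual E) \<Longrightarrow> x \<notin> vecs E \<Longrightarrow> f x = 0"
  and dual_add: "f \<in> vecs (dual E) \<Longrightarrow> x \<in> vecs E \<Longrightarrow> y \<in> vecs E \<Longrightarrow> f (x + y) = f x + f y"
  and dual_scl: "f \<in> vecs (dual E) \<Longrightarrow> x \<in> vecs E \<Longrightarrow> f (scl E a x) = a * f x"
  by (simp_all add: dual_def)

lemma dual_zero: "f \<in> vecs (dual E) \<Longrightarrow> f 0 = 0"
  using dual_add[of f 0 0] zero_mem by simp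

lemma dual_diff:
  assumes "f \<in> vecs (dual E)" "x \<in> vecs E" "y \<in> vecs E"
  shows "f (x - y) = f x - f y"
  using dual_add[OF assms(1) diff_mem[OF assms(2,3)] assms(3)] by simp

lemma scl_dual: "scl (dual E) a f = (\<lambda>x. a * f x)"
  by (simp add: dual_def)

lemma dual_nrm_le:
  assumes "\<And>x. x \<in> vecs E \<Longrightarrow> nrm E x \<le> 1 \<Longrightarrow> norm (f x) \<le> C"
  shows "nrm (dual E) f \<le> C"
proof -
  have "0 \<in> {x \<in> vecs E. nrm E x \<le> 1}" by (simp add: zero_mem nrm_zero)
  then show ?thesis unfolding dual_def using assms by (auto intro!: cSUP_least)
qed

lemma dual_le_nrm:
  assumes f: "f \<in> vecs (dual E)" and x: "x \<in> vecs E" "nrm E x \<le> 1"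
  shows "norm (f x) \<le> nrm (dual E) f"
proof -
  obtain B where B: "\<And>x. x \<in> vecs E \<Longrightarrow> norm (f x) \<le> B * nrm E x"
    using f by (force simp: dual_def)
  have "norm (f y) \<le> \<bar>B\<bar>" if "y \<in> vecs E" "nrm E y \<le> 1" for y
  proof -
    have "norm (f y) \<le> \<bar>B\<bar> * nrm E y"
      using B[OF that(1)] nrm_nonneg[OF that(1)]
      by (meson abs_ge_self mult_right_mono order_trans)
    also have "\<dots> \<le> \<bar>B\<bar> * 1" using that by (intro mult_left_mono) auto
    finally show ?thesis by simp
  qed
  then have "bdd_above ((\<lambda>x. norm (f x)) ` {x \<in> vecs E. nrm E x \<le> 1})"
    by (intro bdd_aboveI2[of _ _ "\<bar>B\<bar>"]) auto
  then show ?thesis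
    unfolding dual_def using x by (auto intro!: cSUP_upper)
qed

lemma dual_bound:
  assumes f: "f \<in> vecs (dual E)" and x: "x \<in> vecs E"
  shows "norm (f x) \<le> nrm (dual E) f * nrm E x"
proof (cases "x = 0")
  case True
  then show ?thesis using dual_zero[OF f] nrm_zero by simp
next
  case False
  have "norm (f (normed_vec E x)) \<le> nrm (dual E) f"
    using dual_le_nrm[OF f normed_vec_mem[OF x]] nrm_normed_vec[OF x False] by simp
  then show ?thesis
    using nrm_pos[OF x False]
    by (simp add: normed_vec_def dual_scl[OF f x] norm_mult norm_divide field_simps)
qed

lemma dual_memI:
  assumes "\<And>x. x \<notin> vecs E \<Longrightarrow> f x = 0"
    and "\<And>x y. x \<in> vecs E \<Longrightarrow> y \<in> vecs E \<Longrightarrow> f (x + y) = f x + f y"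
    and "\<And>a x. x \<in> vecs E \<Longrightarrow> f (scl E a x) = a * f x"
    and "\<And>x. x \<in> vecs E \<Longrightarrow> norm (f x) \<le> B * nrm E x"
  shows "f \<in> vecs (dual E)"
proof -
  have "\<exists>B. \<forall>x\<in>vecs E. norm (f x) \<le> B * nrm E x" using assms(4) by blast
  then show ?thesis using assms(1-3) by (simp add: dual_def)
qed

lemma normed_space_dual: "normed_space (dual E)"
proof
  fix f g :: "'e \<Rightarrow> 'k" and a b :: 'k
  show "0 \<in> vecs (dual E)" by (rule dual_memI[where B = 0]) auto
  assume f: "f \<in> vecs (dual E)"
  show "scl (dual E) a f \<in> vecs (dual E)"
    unfolding scl_dual
  proof (rule dual_memI[where B = "norm a * nrm (dual E) f"])
    show "norm (a * f x) \<le> norm a * nrm (dual E) f * nrm E x" if "x \<in> vecs E" for x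
      using mult_left_mono[OF dual_bound[OF f that], of "norm a"] by (simp add: norm_mult mult.assoc)
  qed (simp_all add: dual_off[OF f] dual_add[OF f] dual_scl[OF f] algebra_simps)
  show "scl (dual E) (a + b) f = scl (dual E) a f + scl (dual E) b f"
    "scl (dual E) a (scl (dual E) b f) = scl (dual E) (a * b) f"
    "scl (dual E) 1 f = f"
    by (simp_all add: scl_dual fun_eq_iff algebra_simps)
  show "nrm (dual E) f = 0 \<longleftrightarrow> f = 0"
  proof
    assume "nrm (dual E) f = 0"
    then have "f x = 0" for x
      using dual_bound[OF f, of x] dual_off[OF f, of x] by (cases "x \<in> vecs E") auto
    then show "f = 0" by (simp add: fun_eq_iff)
  next
    assume z: "f = 0"
    have "nrm (dual E) f \<le> 0" by (rule dual_nrm_le) (simp add: z)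
    moreover have "0 \<le> nrm (dual E) f"
      using dual_le_nrm[OF f zero_mem] by (simp add: nrm_zero z)
    ultimately show "nrm (dual E) f = 0" by simp
  qed
  have nn: "0 \<le> nrm (dual E) h" if "h \<in> vecs (dual E)" for h
    using dual_le_nrm[OF that zero_mem] by (simp add: nrm_zero dual_zero[OF that])
  have le: "nrm (dual E) (scl (dual E) c h) \<le> norm c * nrm (dual E) h"
    if "h \<in> vecs (dual E)" for c h
    by (rule dual_nrm_le) (simp add: scl_dual norm_mult mult_left_mono dual_le_nrm[OF that])
  show "nrm (dual E) (scl (dual E) a f) = norm a * nrm (dual E) f"
  proof (rule antisym[OF le[OF f]])
    show "norm a * nrm (dual E) f \<le> nrm (dual E) (scl (dual E) a f)"
    proof (cases "a = 0")
      case True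
      then show ?thesis using nn[OF \<open>scl (dual E) a f \<in> vecs (dual E)\<close>] by simp
    next
      case False
      have "scl (dual E) (1 / a) (scl (dual E) a f) = f"
        using False by (simp add: scl_dual)
      then show ?thesis
        using le[OF \<open>scl (dual E) a f \<in> vecs (dual E)\<close>, of "1 / a"] False
        by (simp add: norm_divide field_simps)
    qed
  qed
  assume g: "g \<in> vecs (dual E)"
  show "f + g \<in> vecs (dual E)"
  proof (rule dual_memI[where B = "nrm (dual E) f + nrm (dual E) g"])
    show "norm ((f + g) x) \<le> (nrm (dual E) f + nrm (dual E) g) * nrm E x" if "x \<in> vecs E" for x
      using norm_triangle_ineq[of "f x" "g x"] dual_bound[OF f that] dual_bound[OF g that]
      by (simp add: algebra_simps)
  qed (simp_all add: dual_off[OF f] dual_add[OF f] dual_scl[OF f]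
        dual_off[OF g] dual_add[OF g] dual_scl[OF g] algebra_simps)
  show "scl (dual E) a (f + g) = scl (dual E) a f + scl (dual E) a g"
    by (simp add: scl_dual fun_eq_iff algebra_simps)
  show "nrm (dual E) (f + g) \<le> nrm (dual E) f + nrm (dual E) g"
  proof (rule dual_nrm_le)
    fix x assume x: "x \<in> vecs E" "nrm E x \<le> 1"
    show "norm ((f + g) x) \<le> nrm (dual E) f + nrm (dual E) g"
      using norm_triangle_ineq[of "f x" "g x"] dual_le_nrm[OF f x] dual_le_nrm[OF g x] by simp
  qed
qed

section \<open>The weak-star topology\<close>

lemma state_space_subset_dual: "state_space E x \<subseteq> vecs (dual E)"
  by (auto simp: state_space_def unit_sphere_def)

lemma topspace_weak_star: "topspace (weak_star E) = vecs (dual E)"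
  by (auto simp: weak_star_def topspace_pullback_topology)

lemma continuous_map_weak_star_eval:
  assumes "x \<in> vecs E"
  shows "continuous_map (weak_star E) euclidean (\<lambda>f. f x)"
proof -
  have "continuous_map (weak_star E) euclidean ((\<lambda>g. g x) \<circ> (\<lambda>f. restrict f (vecs E)))"
    unfolding weak_star_def
    using assms by (intro continuous_map_pullback continuous_map_product_projection)
  then show ?thesis using assms by (simp add: o_def)
qed

lemma continuous_map_into_weak_star:
  assumes "\<And>t. t \<in> topspace T \<Longrightarrow> \<phi> t \<in> vecs (dual E)"
    and "\<And>x. x \<in> vecs E \<Longrightarrow> continuous_map T euclidean (\<lambda>t. \<phi> t x)"
  shows "continuous_map T (weak_star E) \<phi>"
  unfolding weak_star_def
proof (rule continuous_map_pullback')
  show "continuous_map T (product_topology (\<lambda>x. euclidean) (vecs E)) ((\<lambda>f. restrict f (vecs E)) \<circ> \<phi>)"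
    unfolding continuous_map_componentwise using assms(2) by (auto simp: o_def)
qed (use assms(1) in auto)

text \<open>
  Balls around \<open>f\<close> form a neighbourhood base at \<open>f\<close> in the norm topology, so continuity of the identity
  at \<open>f\<close> becomes a condition that can be transported between spaces by weak-star continuous maps.
\<close>

lemma wstar_norm_continuous_at_iff:
  assumes K: "K \<subseteq> vecs (dual E)" and f: "f \<in> K"
  shows "topcontinuous_at (subtopology (weak_star E) K) (subtopology (norm_topology (dual E)) K)
      (\<lambda>g. g) f \<longleftrightarrow>
    (\<forall>e>0. \<exists>U. openin (weak_star E) U \<and> f \<in> U \<and> (\<forall>g\<in>U \<inter> K. nrm (dual E) (g - f) < e))"
    (is "?L \<longleftrightarrow> ?R")
proof -
  interpret D: normed_space "dual E" by (rule normed_space_dual)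
  interpret M: Metric_space "vecs (dual E)" "ndist (dual E)" by (rule D.Metric_space_ndist)
  have nt: "norm_topology (dual E) = M.mtopology" by (simp add: norm_topology_def)
  have dist: "ndist (dual E) f g = nrm (dual E) (g - f)" if "g \<in> K" for g
    using that K f D.nrm_minus[OF D.diff_mem, of f g] by (auto simp: ndist_def)
  show ?thesis
  proof
    assume L: ?L
    show ?R
    proof (intro allI impI)
      fix e :: real assume "0 < e"
      then have ball: "openin (subtopology (norm_topology (dual E)) K) (M.mball f e \<inter> K)"
        "f \<in> M.mball f e \<inter> K"
        using f K by (auto simp: nt openin_subtopology)
      have "\<exists>V. openin (subtopology (weak_star E) K) V \<and> f \<in> V \<and> (\<forall>g\<in>V. g \<in> M.mball f e \<inter> K)"
        using L[unfolded topcontinuous_at_def, THEN conjunct2, THEN conjunct2, THEN spec, THEN mp, OF conjI[OF ball]] .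
      then obtain V where V: "openin (subtopology (weak_star E) K) V" "f \<in> V" "V \<subseteq> M.mball f e"
        by blast
      from V(1) obtain U where U: "openin (weak_star E) U" "V = U \<inter> K"
        by (auto simp: openin_subtopology)
      have "nrm (dual E) (g - f) < e" if "g \<in> U \<inter> K" for g
      proof -
        have "g \<in> M.mball f e" using that V(3) U(2) by blast
        then show ?thesis using dist[of g] that by simp
      qed
      then show "\<exists>U. openin (weak_star E) U \<and> f \<in> U \<and> (\<forall>g\<in>U \<inter> K. nrm (dual E) (g - f) < e)"
        using U V(2) by blast
    qed
  next
    assume R: ?R
    show ?L
      unfolding topcontinuous_at_def
    proof (intro conjI allI impI)
      show "f \<in> topspace (subtopology (weak_star E) K)"
        using f K by (auto simp: topspace_weak_star)
      show "(\<lambda>g. g) \<in> topspace (subtopology (weak_star E) K)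
          \<rightarrow> topspace (subtopology (norm_topology (dual E)) K)"
        by (auto simp: topspace_weak_star nt)
    next
      fix V assume "openin (subtopology (norm_topology (dual E)) K) V \<and> f \<in> V"
      then obtain W where W: "openin M.mtopology W" "V = W \<inter> K" "f \<in> W"
        by (auto simp: openin_subtopology nt)
      then obtain e where e: "0 < e" "M.mball f e \<subseteq> W"
        by (auto simp: M.openin_mtopology)
      obtain U where U: "openin (weak_star E) U" "f \<in> U" "\<forall>g\<in>U \<inter> K. nrm (dual E) (g - f) < e"
        using R e(1) by blast
      have "g \<in> V" if g: "g \<in> U \<inter> K" for g
      proof -
        have "ndist (dual E) f g < e" using g U(3) dist[of g] by simp
        then have "g \<in> M.mball f e" using g f K by auto
        then show ?thesis using e(2) W(2) g by blast
      qed
      moreover have "openin (subtopology (weak_star E) K) (U \<inter> K)"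
        using U(1) by (auto simp: openin_subtopology)
      ultimately show "\<exists>U. openin (subtopology (weak_star E) K) U \<and> f \<in> U \<and> (\<forall>g\<in>U. g \<in> V)"
        using U(2) f by blast
    qed
  qed
qed

end

section \<open>Power inequalities\<close>

text \<open>
  The limit version of the triangle inequality for a range of sort \<open>real_normed_vector\<close>: the scalar
  class is not declared complete.
\<close>

lemma norm_limit_sums_le:
  fixes f :: "nat \<Rightarrow> 'a::real_normed_vector"
  assumes "f sums a" "g sums b" "\<And>i. norm (f i) \<le> g i"
  shows "norm a \<le> b"
proof (rule LIMSEQ_le)
  show "(\<lambda>n. norm (\<Sum>i<n. f i)) \<longlonglongrightarrow> norm a" "(\<lambda>n. \<Sum>i<n. g i) \<longlonglongrightarrow> b"
    using assms(1,2) by (auto simp: sums_def intro: tendsto_norm)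
  show "\<exists>N. \<forall>n\<ge>N. norm (\<Sum>i<n. f i) \<le> (\<Sum>i<n. g i)"
    using assms(3) by (auto intro: sum_norm_le)
qed

lemma Young_powr:
  fixes a b p :: real
  assumes "1 < p" "0 \<le> a" "0 \<le> b"
  shows "a powr (p - 1) * b \<le> (1 - 1 / p) * a powr p + b powr p / p"
proof -
  have q: "1 < p / (p - 1)" "1 / p + 1 / (p / (p - 1)) = 1"
    using assms(1) by (simp_all add: field_simps)
  have "a powr (p - 1) * b = b * a powr (p - 1)" by simp
  also have "\<dots> \<le> b powr p / p + (a powr (p - 1)) powr (p / (p - 1)) / (p / (p - 1))"
    using Youngs_inequality[OF assms(1) q(1) q(2) assms(3), of "a powr (p - 1)"] by simp
  also have "(a powr (p - 1)) powr (p / (p - 1)) = a powr p"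
    using assms(1) by (simp add: powr_powr)
  also have "a powr p / (p / (p - 1)) = (1 - 1 / p) * a powr p"
    using assms(1) by (simp add: field_simps)
  finally show ?thesis by simp
qed

lemma powr_minus_one_mult:
  fixes a p :: real
  assumes "0 \<le> a" "p \<noteq> 0"
  shows "a powr (p - 1) * a = a powr p"
  using assms powr_mult_base[of a "p - 1"] by (cases "a = 0") (simp_all add: mult.commute)

text \<open>
  Applying Young's inequality to \<open>a\<close> and \<open>b / s\<close> puts the factor \<open>s\<^sup>1\<^sup>-\<^sup>p\<close> in front of \<open>b\<^sup>p\<close>, which is
  as small as desired for large \<open>s\<close>.
\<close>

lemma Young_powr_eps:
  fixes e p :: real
  assumes "1 < p" "0 < e"
  obtains s where "0 < s"
    and "\<And>a b. 0 \<le> a \<Longrightarrow> 0 \<le> b \<Longrightarrow> a powr (p - 1) * b \<le> s * a powr p + e * b powr p"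
proof
  define s where "s = e powr (1 / (1 - p))"
  show "0 < s" using assms by (simp add: s_def)
  have s: "s * (1 / s powr p) = e"
  proof -
    have "s * (1 / s powr p) = s powr (1 - p)"
      using \<open>0 < s\<close> by (simp add: powr_diff)
    also have "\<dots> = e" using assms by (simp add: s_def powr_powr)
    finally show ?thesis .
  qed
  fix a b :: real assume ab: "0 \<le> a" "0 \<le> b"
  have "a powr (p - 1) * (b / s) \<le> (1 - 1 / p) * a powr p + (b / s) powr p / p"
    using Young_powr[OF assms(1) ab(1), of "b / s"] ab \<open>0 < s\<close> by simp
  also have "\<dots> \<le> 1 * a powr p + (b / s) powr p / 1"
    using assms(1) by (intro add_mono mult_right_mono divide_left_mono) auto
  finally have "s * (a powr (p - 1) * (b / s)) \<le> s * (a powr p + b powr p * (1 / s powr p))"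
    using ab \<open>0 < s\<close> by (intro mult_left_mono) (simp_all add: powr_divide)
  also have "\<dots> = s * a powr p + (s * (1 / s powr p)) * b powr p"
    by (simp add: algebra_simps)
  finally show "a powr (p - 1) * b \<le> s * a powr p + e * b powr p"
    unfolding s using \<open>0 < s\<close> by simp
qed

text \<open>
  With \<open>m\<close> the weighted mean, Young's inequality bounds \<open>m\<^sup>p\<^sup>-\<^sup>1 a\<close> and \<open>m\<^sup>p\<^sup>-\<^sup>1 b\<close>; the weighted sum of
  these bounds is a bound of \<open>m\<^sup>p\<close> by \<open>(1 - 1/p) m\<^sup>p\<close> plus \<open>1/p\<close> times the right-hand side.
\<close>

lemma convex_powr_nonneg:
  fixes a b u v p :: real
  assumes "1 < p" "0 \<le> a" "0 \<le> b" "0 \<le> u" "0 \<le> v" "u + v = 1"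
  shows "(u * a + v * b) powr p \<le> u * a powr p + v * b powr p"
proof -
  define m where "m = u * a + v * b"
  have m: "0 \<le> m" using assms by (simp add: m_def)
  have "m powr p = m powr (p - 1) * m" using powr_minus_one_mult[of m p] assms m by simp
  also have "\<dots> = u * (m powr (p - 1) * a) + v * (m powr (p - 1) * b)"
    by (simp add: m_def algebra_simps)
  also have "\<dots> \<le> u * ((1 - 1 / p) * m powr p + a powr p / p)
      + v * ((1 - 1 / p) * m powr p + b powr p / p)"
    using assms m by (intro add_mono mult_left_mono Young_powr) auto
  also have "\<dots> = (u + v) * ((1 - 1 / p) * m powr p) + (u * a powr p + v * b powr p) / p"
    by (simp add: algebra_simps add_divide_distrib)
  finally have "m powr p / p \<le> (u * a powr p + v * b powr p) / p"
    using assms(6) by (simp add: algebra_simps)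
  then show ?thesis using assms(1) by (simp add: m_def divide_le_cancel)
qed

section \<open>The sequence space as a normed space\<close>

definition single :: "nat \<Rightarrow> 'e::zero \<Rightarrow> nat \<Rightarrow> 'e" where
  "single i z = 0(i := z)"

text \<open>Cut off outside the carrier, as elements of the dual are.\<close>

definition component ::
    "('k::real_normed_field, 'e::ab_group_add) nspace \<Rightarrow> nat \<Rightarrow> ((nat \<Rightarrow> 'e) \<Rightarrow> 'k) \<Rightarrow> 'e \<Rightarrow> 'k" where
  "component E i G = (\<lambda>z. if z \<in> vecs E then G (single i z) else 0)"

definition at_coordinate ::
    "real \<Rightarrow> ('k::real_normed_field, 'e::ab_group_add) nspace \<Rightarrow> nat \<Rightarrow> ('e \<Rightarrow> 'k) \<Rightarrow> (nat \<Rightarrow> 'e) \<Rightarrow> 'k" where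
  "at_coordinate p E i h = (\<lambda>y. if y \<in> vecs (lp p E) then h (y i) else 0)"

lemma component_add: "component E i (G + H) = component E i G + component E i H"
  and component_diff: "component E i (G - H) = component E i G - component E i H"
  by (auto simp: component_def fun_eq_iff)

locale lp_space = normed_space X
  for X :: "('k::real_or_complex, 'e::ab_group_add) nspace" +
  fixes p :: real
  assumes p_gt_1: "1 < p"
begin

lemma lp_mem: "y \<in> vecs (lp p X) \<Longrightarrow> y i \<in> vecs X"
  and lp_summable: "y \<in> vecs (lp p X) \<Longrightarrow> summable (\<lambda>i. nrm X (y i) powr p)"
  and lp_memI: "(\<And>i. y i \<in> vecs X) \<Longrightarrow> summable (\<lambda>i. nrm X (y i) powr p) \<Longrightarrow> y \<in> vecs (lp p X)"
  and scl_lp: "scl (lp p X) a y = (\<lambda>i. scl X a (y i))"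
  by (simp_all add: lp_def)

lemma nrm_lp_nonneg: "0 \<le> nrm (lp p X) y"
  by (simp add: lp_def)

lemma lp_sums:
  assumes "y \<in> vecs (lp p X)"
  shows "(\<lambda>i. nrm X (y i) powr p) sums (nrm (lp p X) y powr p)"
proof -
  have "nrm (lp p X) y powr p = (\<Sum>i. nrm X (y i) powr p)"
    using p_gt_1 suminf_nonneg[OF lp_summable[OF assms]]
    by (simp add: lp_def powr_powr)
  then show ?thesis using lp_summable[OF assms] by (simp add: summable_sums)
qed

lemma nrm_lp_le:
  assumes "0 \<le> C" and "nrm (lp p X) y powr p \<le> C powr p"
  shows "nrm (lp p X) y \<le> C"
  using assms p_gt_1 powr_less_mono2[of p C "nrm (lp p X) y"] by fastforce

lemma scl_zero_right: "scl X a 0 = 0"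
  using nrm_scl[OF zero_mem, of a] nrm_zero nrm_eq_0_iff[OF scl_mem[OF zero_mem]] by simp

text \<open>
  Convexity of the \<open>p\<close>-th power, applied to \<open>(A + B) (u (a / A) + v (b / B))\<close> with the weights
  \<open>u = A / (A + B)\<close> and \<open>v = B / (A + B)\<close>. Strict upper bounds \<open>A\<close> and \<open>B\<close> in place of the norms
  themselves keep the divisors positive.
\<close>

lemma Minkowski:
  assumes x: "x \<in> vecs (lp p X)" and y: "y \<in> vecs (lp p X)"
    and A: "nrm (lp p X) x < A" and B: "nrm (lp p X) y < B"
  shows "x + y \<in> vecs (lp p X)" and "nrm (lp p X) (x + y) \<le> A + B"
proof -
  have pos: "0 < A" "0 < B" using A B nrm_lp_nonneg[of x] nrm_lp_nonneg[of y] by auto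
  define u v where "u = A / (A + B)" and "v = B / (A + B)"
  have uv: "0 \<le> u" "0 \<le> v" "u + v = 1"
    using pos by (auto simp: u_def v_def simp flip: add_divide_distrib)
  define T where "T i = (A + B) powr p *
    (u * (nrm X (x i) powr p / A powr p) + v * (nrm X (y i) powr p / B powr p))" for i
  have T: "T sums ((A + B) powr p *
    (u * (nrm (lp p X) x powr p / A powr p) + v * (nrm (lp p X) y powr p / B powr p)))"
    unfolding T_def by (intro sums_mult sums_add sums_divide lp_sums x y)
  have le: "nrm X (x i + y i) powr p \<le> T i" for i
  proof -
    have nn: "0 \<le> nrm X (x i)" "0 \<le> nrm X (y i)" "0 \<le> nrm X (x i + y i)"
      by (simp_all add: nrm_nonneg add_mem lp_mem[OF x] lp_mem[OF y])
    have "nrm X (x i + y i) \<le> (A + B) * (u * (nrm X (x i) / A) + v * (nrm X (y i) / B))"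
      using nrm_triangle[OF lp_mem[OF x] lp_mem[OF y], of i i] pos
      by (simp add: u_def v_def distrib_left)
    then have "nrm X (x i + y i) powr p
        \<le> ((A + B) * (u * (nrm X (x i) / A) + v * (nrm X (y i) / B))) powr p"
      using nn p_gt_1 by (intro powr_mono2) auto
    also have "\<dots> = (A + B) powr p * (u * (nrm X (x i) / A) + v * (nrm X (y i) / B)) powr p"
      by (rule powr_mult)
    also have "\<dots> \<le> (A + B) powr p * (u * (nrm X (x i) / A) powr p + v * (nrm X (y i) / B) powr p)"
      using nn pos uv p_gt_1 by (intro mult_left_mono convex_powr_nonneg) auto
    finally show ?thesis using nn pos by (simp add: T_def powr_divide)
  qed
  have summable: "summable (\<lambda>i. nrm X (x i + y i) powr p)"
    by (rule summable_comparison_test'[OF sums_summable[OF T], of 0]) (use le in auto)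
  then show mem: "x + y \<in> vecs (lp p X)"
    by (intro lp_memI) (auto simp: add_mem lp_mem[OF x] lp_mem[OF y])
  have "nrm (lp p X) (x + y) powr p \<le> (A + B) powr p *
    (u * (nrm (lp p X) x powr p / A powr p) + v * (nrm (lp p X) y powr p / B powr p))"
    using sums_le[OF _ lp_sums[OF mem] T] le by simp
  also have "\<dots> \<le> (A + B) powr p * (u * 1 + v * 1)"
    using A B pos uv p_gt_1 nrm_lp_nonneg[of x] nrm_lp_nonneg[of y]
    by (intro mult_left_mono add_mono) (auto intro!: powr_mono2)
  finally show "nrm (lp p X) (x + y) \<le> A + B"
    using pos uv(3) by (intro nrm_lp_le) auto
qed

lemma nrm_coordinate_le:
  assumes "y \<in> vecs (lp p X)"
  shows "nrm X (y i) \<le> nrm (lp p X) y"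
proof -
  have "nrm X (y i) powr p \<le> nrm (lp p X) y powr p"
    using sum_le_suminf[OF lp_summable[OF assms], of "{i}"] lp_sums[OF assms] by (simp add: sums_iff)
  then show ?thesis
    using p_gt_1 powr_less_mono2[of p "nrm (lp p X) y" "nrm X (y i)"] nrm_lp_nonneg[of y] by fastforce
qed

lemma normed_space_lp: "normed_space (lp p X)"
proof
  fix x y :: "nat \<Rightarrow> 'e" and a b :: 'k
  show "0 \<in> vecs (lp p X)" using p_gt_1 by (intro lp_memI) (auto simp: zero_mem nrm_zero)
  assume x: "x \<in> vecs (lp p X)"
  have scl_eq: "nrm X (scl X a (x i)) powr p = norm a powr p * nrm X (x i) powr p" for i
    by (simp add: nrm_scl lp_mem[OF x] powr_mult nrm_nonneg)
  have scl_sums: "(\<lambda>i. nrm X (scl X a (x i)) powr p) sums (norm a powr p * nrm (lp p X) x powr p)"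
    unfolding scl_eq by (intro sums_mult lp_sums x)
  show mem: "scl (lp p X) a x \<in> vecs (lp p X)"
    unfolding scl_lp using sums_summable[OF scl_sums] by (intro lp_memI scl_mem lp_mem[OF x])
  show "scl (lp p X) (a + b) x = scl (lp p X) a x + scl (lp p X) b x"
    "scl (lp p X) a (scl (lp p X) b x) = scl (lp p X) (a * b) x"
    "scl (lp p X) 1 x = x"
    by (simp_all add: scl_lp fun_eq_iff scl_add_left scl_scl scl_one lp_mem[OF x])
  show "nrm (lp p X) x = 0 \<longleftrightarrow> x = 0"
  proof
    assume "nrm (lp p X) x = 0"
    then have "(\<Sum>i. nrm X (x i) powr p) = 0" using lp_sums[OF x] p_gt_1 by (simp add: sums_iff)
    then have "nrm X (x i) powr p = 0" for i
      using suminf_eq_zero_iff[OF lp_summable[OF x]] by simp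
    then show "x = 0" by (simp add: fun_eq_iff nrm_eq_0_iff lp_mem[OF x])
  next
    assume "x = 0"
    then show "nrm (lp p X) x = 0" by (simp add: lp_def nrm_zero)
  qed
  have "nrm (lp p X) (scl (lp p X) a x) powr p = norm a powr p * nrm (lp p X) x powr p"
    using sums_unique2[OF lp_sums[OF mem]] scl_sums by (simp add: scl_lp)
  also have "\<dots> = (norm a * nrm (lp p X) x) powr p" by (simp add: powr_mult nrm_lp_nonneg)
  finally have eq: "nrm (lp p X) (scl (lp p X) a x) powr p = (norm a * nrm (lp p X) x) powr p" .
  show "nrm (lp p X) (scl (lp p X) a x) = norm a * nrm (lp p X) x"
    using arg_cong[OF eq, of "\<lambda>t. t powr (1 / p)"] p_gt_1 by (simp add: powr_powr nrm_lp_nonneg)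
  assume y: "y \<in> vecs (lp p X)"
  show "x + y \<in> vecs (lp p X)"
    by (rule Minkowski(1)[OF x y less_add_one less_add_one])
  show "scl (lp p X) a (x + y) = scl (lp p X) a x + scl (lp p X) a y"
    by (simp add: scl_lp fun_eq_iff scl_add_right lp_mem[OF x] lp_mem[OF y])
  show "nrm (lp p X) (x + y) \<le> nrm (lp p X) x + nrm (lp p X) y"
  proof (rule field_le_epsilon)
    fix e :: real assume "0 < e"
    then show "nrm (lp p X) (x + y) \<le> nrm (lp p X) x + nrm (lp p X) y + e"
      using Minkowski(2)[OF x y, of "nrm (lp p X) x + e / 2" "nrm (lp p X) y + e / 2"] by simp
  qed
qed

lemma lp_upd:
  assumes y: "y \<in> vecs (lp p X)" and z: "z \<in> vecs X"
  shows "y(i := z) \<in> vecs (lp p X)"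
    and "nrm (lp p X) (y(i := z)) powr p = nrm (lp p X) y powr p - nrm X (y i) powr p + nrm X z powr p"
proof -
  have eq: "(\<lambda>j. nrm X ((y(i := z)) j) powr p) = (\<lambda>j. nrm X (y j) powr p +
      (if j = i then nrm X z powr p - nrm X (y i) powr p else 0))"
    by (auto simp: fun_eq_iff)
  have sums: "(\<lambda>j. nrm X ((y(i := z)) j) powr p) sums
      (nrm (lp p X) y powr p + (nrm X z powr p - nrm X (y i) powr p))"
    unfolding eq by (intro sums_add lp_sums y sums_single)
  show mem: "y(i := z) \<in> vecs (lp p X)"
    using sums_summable[OF sums] by (intro lp_memI) (auto simp: z lp_mem[OF y])
  show "nrm (lp p X) (y(i := z)) powr p = nrm (lp p X) y powr p - nrm X (y i) powr p + nrm X z powr p"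
    using sums_unique2[OF lp_sums[OF mem] sums] by simp
qed

lemma
  assumes "z \<in> vecs X"
  shows single_mem: "single i z \<in> vecs (lp p X)" and nrm_single: "nrm (lp p X) (single i z) = nrm X z"
proof -
  interpret L: normed_space "lp p X" by (rule normed_space_lp)
  show "single i z \<in> vecs (lp p X)" unfolding single_def by (rule lp_upd(1)[OF L.zero_mem assms])
  have "nrm (lp p X) (single i z) powr p = nrm X z powr p"
    unfolding single_def using lp_upd(2)[OF L.zero_mem assms, of i] p_gt_1
    by (simp add: L.nrm_zero nrm_zero)
  from arg_cong[OF this, of "\<lambda>t. t powr (1 / p)"] show "nrm (lp p X) (single i z) = nrm X z"
    using p_gt_1 nrm_nonneg[OF assms] by (simp add: powr_powr nrm_lp_nonneg)
qed

section \<open>Coordinates of functionals on the sequence space\<close>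

lemma component_mem:
  assumes G: "G \<in> vecs (dual (lp p X))"
  shows "component X i G \<in> vecs (dual X)"
proof -
  interpret L: normed_space "lp p X" by (rule normed_space_lp)
  show ?thesis
  proof (rule dual_memI[where B = "nrm (dual (lp p X)) G"])
    fix x y assume x: "x \<in> vecs X"
    show "norm (component X i G x) \<le> nrm (dual (lp p X)) G * nrm X x"
      using L.dual_bound[OF G single_mem[OF x]] x by (simp add: component_def nrm_single)
    have "single i (scl X a x) = scl (lp p X) a (single i x)" for a
      by (auto simp: single_def scl_lp fun_eq_iff scl_zero_right)
    then show "component X i G (scl X a x) = a * component X i G x" for a
      using x by (simp add: component_def scl_mem L.dual_scl[OF G] single_mem)
    assume y: "y \<in> vecs X"
    have "single i (x + y) = single i x + single i y"
      by (auto simp: single_def fun_eq_iff)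
    then show "component X i G (x + y) = component X i G x + component X i G y"
      using x y by (simp add: component_def add_mem L.dual_add[OF G] single_mem)
  qed (simp add: component_def)
qed

lemma nrm_component_le:
  assumes G: "G \<in> vecs (dual (lp p X))"
  shows "nrm (dual X) (component X i G) \<le> nrm (dual (lp p X)) G"
proof -
  interpret L: normed_space "lp p X" by (rule normed_space_lp)
  show ?thesis
    by (rule dual_nrm_le) (simp add: component_def L.dual_le_nrm[OF G] single_mem nrm_single)
qed

lemma at_coordinate_mem:
  assumes h: "h \<in> vecs (dual X)"
  shows "at_coordinate p X i h \<in> vecs (dual (lp p X))"
proof -
  interpret L: normed_space "lp p X" by (rule normed_space_lp)
  interpret D: normed_space "dual X" by (rule normed_space_dual)
  show ?thesis
  proof (rule L.dual_memI[where B = "nrm (dual X) h"])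
    fix x assume x: "x \<in> vecs (lp p X)"
    have "norm (h (x i)) \<le> nrm (dual X) h * nrm (lp p X) x"
      using dual_bound[OF h lp_mem[OF x], of i] D.nrm_nonneg[OF h] nrm_coordinate_le[OF x, of i]
      by (meson mult_left_mono order_trans)
    then show "norm (at_coordinate p X i h x) \<le> nrm (dual X) h * nrm (lp p X) x"
      using x by (simp add: at_coordinate_def)
    have "scl (lp p X) a x i = scl X a (x i)" for a by (simp add: scl_lp)
    then show "at_coordinate p X i h (scl (lp p X) a x) = a * at_coordinate p X i h x" for a
      using x by (simp add: at_coordinate_def L.scl_mem lp_mem dual_scl[OF h])
  qed (simp_all add: at_coordinate_def L.add_mem lp_mem dual_add[OF h])
qed

lemma component_at_coordinate:
  assumes h: "h \<in> vecs (dual X)"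
  shows "component X j (at_coordinate p X i h) = (if j = i then h else 0)"
proof -
  have "single j z i = (if j = i then z else 0)" for z :: 'e
    by (simp add: single_def)
  then show ?thesis
    by (auto simp: component_def at_coordinate_def fun_eq_iff single_mem dual_zero[OF h] dual_off[OF h])
qed

text \<open>
  The partial sums are the values of \<open>G\<close> at truncations of \<open>y\<close>, and these converge to \<open>y\<close> in norm since \<open>p\<close> is
  finite.
\<close>

lemma dual_lp_sums:
  assumes G: "G \<in> vecs (dual (lp p X))" and y: "y \<in> vecs (lp p X)"
  shows "(\<lambda>i. component X i G (y i)) sums G y"
proof -
  interpret L: normed_space "lp p X" by (rule normed_space_lp)
  define head tail where "head n = (\<lambda>j. if j < n then y j else 0)"
    and "tail n = (\<lambda>j. if j < n then 0 else y j)" for n :: nat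
  have head: "head n \<in> vecs (lp p X) \<and> G (head n) = (\<Sum>i<n. component X i G (y i))" for n
  proof (induction n)
    case 0
    have "head 0 = 0" by (simp add: head_def fun_eq_iff)
    then show ?case using L.zero_mem L.dual_zero[OF G] by (simp only: lessThan_0 sum.empty)
  next
    case (Suc n)
    have "head (Suc n) = head n + single n (y n)"
      by (auto simp: head_def single_def fun_eq_iff less_Suc_eq)
    moreover have mem: "single n (y n) \<in> vecs (lp p X)" by (rule single_mem[OF lp_mem[OF y]])
    ultimately have "head (Suc n) \<in> vecs (lp p X)" "G (head (Suc n)) = G (head n) + G (single n (y n))"
      using L.add_mem[OF _ mem, of "head n"] L.dual_add[OF G _ mem, of "head n"] Suc by metis+
    then show ?case using Suc by (simp add: component_def lp_mem[OF y])
  qed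
  have tail_eq: "tail n = y - head n" for n by (auto simp: head_def tail_def fun_eq_iff)
  have tail_mem: "tail n \<in> vecs (lp p X)" for n
    unfolding tail_eq using y head by (blast intro: L.diff_mem)
  have "nrm (lp p X) (tail n) powr p = nrm (lp p X) y powr p - (\<Sum>i<n. nrm X (y i) powr p)" for n
  proof -
    have "(\<lambda>i. nrm X (y i) powr p - (if i \<in> {..<n} then nrm X (y i) powr p else 0)) sums
        (nrm (lp p X) y powr p - (\<Sum>i<n. nrm X (y i) powr p))"
      by (intro sums_diff lp_sums y sums_If_finite_set) simp
    moreover have "(\<lambda>i. nrm X (y i) powr p - (if i \<in> {..<n} then nrm X (y i) powr p else 0))
        = (\<lambda>i. nrm X (tail n i) powr p)"
      using p_gt_1 by (auto simp: tail_def fun_eq_iff nrm_zero)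
    ultimately show ?thesis using sums_unique2[OF lp_sums[OF tail_mem]] by metis
  qed
  moreover have "(\<lambda>n. nrm (lp p X) y powr p - (\<Sum>i<n. nrm X (y i) powr p)) \<longlonglongrightarrow>
      nrm (lp p X) y powr p - nrm (lp p X) y powr p"
    using lp_sums[OF y] by (intro tendsto_diff tendsto_const) (simp add: sums_def)
  ultimately have "(\<lambda>n. nrm (lp p X) (tail n) powr p) \<longlonglongrightarrow> 0" by simp
  then have "(\<lambda>n. (nrm (lp p X) (tail n) powr p) powr (1 / p)) \<longlonglongrightarrow> 0 powr (1 / p)"
    using p_gt_1 by (intro tendsto_powr') (auto intro!: always_eventually)
  then have "(\<lambda>n. nrm (lp p X) (tail n)) \<longlonglongrightarrow> 0"
    using p_gt_1 by (simp add: powr_powr nrm_lp_nonneg)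
  then have lim: "(\<lambda>n. nrm (dual (lp p X)) G * nrm (lp p X) (tail n)) \<longlonglongrightarrow> 0"
    by (rule tendsto_mult_right_zero)
  have "(\<lambda>n. G y - G (head n)) \<longlonglongrightarrow> 0"
  proof (rule Lim_null_comparison[OF _ lim], rule always_eventually, rule allI)
    fix n
    have "G y - G (head n) = G (tail n)"
      unfolding tail_eq using L.dual_diff[OF G y] head by simp
    then show "norm (G y - G (head n)) \<le> nrm (dual (lp p X)) G * nrm (lp p X) (tail n)"
      using L.dual_bound[OF G tail_mem] by simp
  qed
  then have "(\<lambda>n. G y - (G y - G (head n))) \<longlonglongrightarrow> G y - 0"
    by (intro tendsto_diff tendsto_const)
  then show ?thesis by (simp add: sums_def head)
qed

end

section \<open>The state space of a sequence\<close>

context normed_space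
begin

lemma scaled_mem_state_space_iff:
  assumes g: "g \<in> vecs (dual E)" and z: "z \<in> vecs E" "z \<noteq> 0" and c: "0 < c"
  shows "scl (dual E) (of_real (1 / c)) g \<in> state_space E (normed_vec E z) \<longleftrightarrow>
    nrm (dual E) g = c \<and> g z = of_real (c * nrm E z)"
proof -
  interpret D: normed_space "dual E" by (rule normed_space_dual)
  have "nrm (dual E) (scl (dual E) (of_real (1 / c)) g) = nrm (dual E) g / c"
    using c by (simp add: D.nrm_scl[OF g] norm_divide)
  moreover have "scl (dual E) (of_real (1 / c)) g (normed_vec E z) = g z / of_real (c * nrm E z)"
    by (simp add: scl_dual normed_vec_def dual_scl[OF g z(1)])
  moreover have "of_real (c * nrm E z) \<noteq> (0 :: 'k)"
    using c nrm_pos[OF z] by simp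
  ultimately show ?thesis
    using c D.scl_mem[OF g]
    by (auto simp: state_space_def unit_sphere_def divide_eq_1_iff divide_eq_eq)
qed

end

definition normalized_component ::
    "real \<Rightarrow> ('k::real_normed_field, 'e::ab_group_add) nspace \<Rightarrow> (nat \<Rightarrow> 'e) \<Rightarrow> nat
      \<Rightarrow> ((nat \<Rightarrow> 'e) \<Rightarrow> 'k) \<Rightarrow> 'e \<Rightarrow> 'k" where
  "normalized_component p E x i G =
     scl (dual E) (of_real (1 / nrm E (x i) powr (p - 1))) (component E i G)"

context lp_space
begin

text \<open>
  Replacing \<open>x\<^sub>i\<close> by \<open>z\<close> changes \<open>G x = 1\<close> to \<open>1 + G\<^sub>i z - G\<^sub>i x\<^sub>i\<close> and \<open>\<parallel>x\<parallel>\<^sup>p = 1\<close> to \<open>1 - a\<^sup>p + \<parallel>z\<parallel>\<^sup>p\<close>,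
  where \<open>a = \<parallel>x\<^sub>i\<parallel>\<close>; as \<open>\<parallel>G\<parallel> = 1\<close>, the real part of the former is at most the \<open>p\<close>-th root of the latter.
  Vectors \<open>z\<close> with \<open>\<parallel>z\<parallel> \<le> a\<close> yield that \<open>G\<^sub>i x\<^sub>i\<close> is the real number \<open>\<parallel>G\<^sub>i\<parallel> a\<close>, and the multiples \<open>z = s x\<^sub>i\<close>
  with \<open>s\<close> near \<open>1\<close> determine it to be \<open>a\<^sup>p\<close>.
\<close>

lemma component_of_state:
  assumes x: "x \<in> unit_sphere (lp p X)" and xi: "x i \<noteq> 0"
    and G: "G \<in> state_space (lp p X) x"
  shows "nrm (dual X) (component X i G) = nrm X (x i) powr (p - 1)"
    and "component X i G (x i) = of_real (nrm X (x i) powr p)"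
proof -
  interpret L: normed_space "lp p X" by (rule normed_space_lp)
  interpret D: normed_space "dual X" by (rule normed_space_dual)
  obtain r :: "'k \<Rightarrow> real" where r_add: "\<And>a b. r (a + b) = r a + r b"
    and r_mult: "\<And>s a. r (of_real s * a) = s * r a"
    and r_le: "\<And>a. r a \<le> norm a" and r_real: "\<And>s. r (of_real s) = s"
    and r_eq: "\<And>a. r a = norm a \<Longrightarrow> a = of_real (norm a)"
    by (rule real_part_functional) blast
  define g where "g = component X i G"
  define a where "a = nrm X (x i)"
  define t where "t = r (g (x i))"
  have xL: "x \<in> vecs (lp p X)" and nx: "nrm (lp p X) x = 1"
    and GL: "G \<in> vecs (dual (lp p X))" and nG: "nrm (dual (lp p X)) G = 1" and Gx: "G x = 1"
    using x G by (auto simp: unit_sphere_def state_space_def)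
  have xX: "x i \<in> vecs X" by (rule lp_mem[OF xL])
  have a: "0 < a" unfolding a_def by (rule nrm_pos[OF xX xi])
  have g: "g \<in> vecs (dual X)" unfolding g_def by (rule component_mem[OF GL])
  have upd: "1 + r (g z) - t \<le> nrm (lp p X) (x(i := z))" if z: "z \<in> vecs X" for z
  proof -
    have d: "z - x i \<in> vecs X" by (rule diff_mem[OF z xX])
    have "x(i := z) = x + single i (z - x i)" by (auto simp: single_def fun_eq_iff)
    then have "G (x(i := z)) = G x + G (single i (z - x i))"
      using L.dual_add[OF GL xL single_mem[OF d]] by simp
    also have "G (single i (z - x i)) = g (z - x i)" using d by (simp add: g_def component_def)
    finally have "G (x(i := z)) + g (x i) = of_real 1 + g z"
      using dual_diff[OF g z xX] Gx by (simp del: fun_upd_apply)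
    then have "r (G (x(i := z))) + t = 1 + r (g z)"
      unfolding t_def by (metis r_add r_real)
    moreover have "r (G (x(i := z))) \<le> nrm (lp p X) (x(i := z))"
      using r_le[of "G (x(i := z))"] L.dual_bound[OF GL lp_upd(1)[OF xL z, of i]] nG by simp
    ultimately show ?thesis by simp
  qed
  have nupd: "nrm (lp p X) (x(i := z)) powr p = 1 - a powr p + nrm X z powr p"
    if "z \<in> vecs X" for z
    using lp_upd(2)[OF xL that, of i] nx by (simp add: a_def)
  have r_max: "r (g z) \<le> t" if z: "z \<in> vecs X" "nrm X z \<le> a" for z
  proof -
    have "nrm (lp p X) (x(i := z)) powr p \<le> 1 powr p"
      using z p_gt_1 nrm_nonneg[OF z(1)] by (simp add: nupd powr_mono2)
    then have "nrm (lp p X) (x(i := z)) \<le> 1" by (intro nrm_lp_le) auto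
    then show ?thesis using upd[OF z(1)] by simp
  qed
  have norm_max: "norm (g z) \<le> t" if z: "z \<in> vecs X" "nrm X z \<le> a" for z
  proof (cases "g z = 0")
    case True
    then show ?thesis using r_max[OF z] r_real[of 0] by simp
  next
    case False
    \<comment> \<open>Rotating \<open>z\<close> by a unimodular scalar makes its value under \<open>g\<close> equal to the absolute value.\<close>
    define w where "w = scl X (of_real (norm (g z)) / g z) z"
    have "nrm X w = nrm X z" "w \<in> vecs X"
      using False z by (simp_all add: w_def nrm_scl scl_mem norm_divide)
    moreover have "g w = of_real (norm (g z))"
      using False z by (simp add: w_def dual_scl[OF g])
    ultimately show ?thesis using r_max[of w] z by (simp add: r_real)
  qed
  have "nrm (dual X) g \<le> t / a"
  proof (rule dual_nrm_le)
    fix z assume z: "z \<in> vecs X" "nrm X z \<le> 1"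
    have "norm (g (scl X (of_real a) z)) \<le> t"
      using z a by (intro norm_max) (auto simp: scl_mem nrm_scl)
    then show "norm (g z) \<le> t / a"
      using z a by (simp add: dual_scl[OF g] norm_mult field_simps)
  qed
  then have le1: "nrm (dual X) g * a \<le> t" using a by (simp add: field_simps)
  have le2: "t \<le> norm (g (x i))" unfolding t_def by (rule r_le)
  have le3: "norm (g (x i)) \<le> nrm (dual X) g * a" unfolding a_def by (rule dual_bound[OF g xX])
  have t_eq: "t = nrm (dual X) g * a" and t_norm: "t = norm (g (x i))" using le1 le2 le3 by auto
  then have gx: "g (x i) = of_real t" using r_eq[of "g (x i)"] by (simp flip: t_def)
  have t0: "0 \<le> t" using t_eq D.nrm_nonneg[OF g] a by simp
  \<comment> \<open>The inequality \<open>upd\<close> at \<open>z = s x\<^sub>i\<close>, raised to the power \<open>p\<close>, reads \<open>\<psi> s \<ge> 0 = \<psi> 1\<close>, so the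
    derivative of \<open>\<psi>\<close> vanishes at \<open>1\<close>. The radius \<open>1 / (2 + 2 t)\<close> keeps \<open>s\<close> and \<open>1 + (s - 1) t\<close> positive.\<close>
  define \<psi> where "\<psi> s = 1 - a powr p + (s * a) powr p - (1 + (s - 1) * t) powr p" for s
  have "(\<psi> has_real_derivative (p * a powr (p - 1) * a - p * t)) (at 1)"
    unfolding \<psi>_def using a by (auto intro!: derivative_eq_intros)
  moreover have "0 < 1 / (2 + 2 * t)" using t0 by simp
  moreover have "\<forall>s. \<bar>1 - s\<bar> < 1 / (2 + 2 * t) \<longrightarrow> \<psi> 1 \<le> \<psi> s"
  proof (intro allI impI)
    fix s assume s: "\<bar>1 - s\<bar> < 1 / (2 + 2 * t)"
    define v u where "v = \<bar>1 - s\<bar>" and "u = v * t"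
    have "v * (2 + 2 * t) < 1" using s t0 by (simp add: v_def field_simps)
    then have small: "2 * v + 2 * u < 1" by (simp add: u_def algebra_simps)
    have nonneg: "0 \<le> v" "0 \<le> u" using t0 by (simp_all add: v_def u_def)
    then have "v < 1" using small by simp
    then have "0 < s" by (simp add: v_def abs_less_iff)
    moreover have "(1 - s) * t \<le> u" unfolding u_def v_def using t0 by (intro mult_right_mono) auto
    then have "(1 - s) * t \<le> 1" using small nonneg by simp
    then have "0 \<le> 1 + (s - 1) * t" by (simp add: algebra_simps)
    ultimately have pos: "0 \<le> 1 + (s - 1) * t" "0 < s" by auto
    let ?z = "scl X (of_real s) (x i)"
    have z: "?z \<in> vecs X" by (rule scl_mem[OF xX])
    have "g ?z = of_real (s * t)" by (simp add: dual_scl[OF g xX] gx)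
    then have "r (g ?z) = s * t" by (simp only: r_real)
    then have "1 + (s - 1) * t \<le> nrm (lp p X) (x(i := ?z))"
      using upd[OF z] by (simp add: algebra_simps)
    then have "(1 + (s - 1) * t) powr p \<le> nrm (lp p X) (x(i := ?z)) powr p"
      using pos p_gt_1 by (intro powr_mono2) auto
    also have "\<dots> = 1 - a powr p + (s * a) powr p"
      using pos by (simp add: nupd[OF z] nrm_scl[OF xX] a_def)
    finally show "\<psi> 1 \<le> \<psi> s" by (simp add: \<psi>_def)
  qed
  ultimately have "p * a powr (p - 1) * a - p * t = 0" by (rule DERIV_local_min)
  then have t: "t = a powr (p - 1) * a" using p_gt_1 by simp
  then show "nrm (dual X) (component X i G) = nrm X (x i) powr (p - 1)"
    using t_eq a by (simp add: g_def a_def)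
  show "component X i G (x i) = of_real (nrm X (x i) powr p)"
    using gx t a p_gt_1 by (simp add: g_def a_def powr_minus_one_mult del: of_real_mult)
qed

text \<open>
  That states restrict to states is \<open>component_of_state\<close>. Conversely, Young's inequality bounds
  \<open>\<bar>G y\<bar> \<le> (\<Sum>i. a\<^sub>i\<^sup>p\<^sup>-\<^sup>1 \<parallel>y\<^sub>i\<parallel>)\<close> by \<open>(1 - 1/p) \<parallel>x\<parallel>\<^sup>p + \<parallel>y\<parallel>\<^sup>p / p \<le> 1\<close> on the unit ball, with \<open>a\<^sub>i = \<parallel>x\<^sub>i\<parallel>\<close>.
\<close>

proposition state_space_lp_iff:
  assumes x: "x \<in> unit_sphere (lp p X)" and x_nz: "\<And>i. x i \<noteq> 0"
    and G: "G \<in> vecs (dual (lp p X))"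
  shows "G \<in> state_space (lp p X) x \<longleftrightarrow>
    (\<forall>i. normalized_component p X x i G \<in> state_space X (normed_vec X (x i)))"
proof -
  interpret L: normed_space "lp p X" by (rule normed_space_lp)
  have xL: "x \<in> vecs (lp p X)" and nx: "nrm (lp p X) x = 1"
    using x by (auto simp: unit_sphere_def)
  have a: "0 < nrm X (x i)" for i by (rule nrm_pos[OF lp_mem[OF xL] x_nz])
  have iff: "normalized_component p X x i G \<in> state_space X (normed_vec X (x i)) \<longleftrightarrow>
      nrm (dual X) (component X i G) = nrm X (x i) powr (p - 1) \<and>
      component X i G (x i) = of_real (nrm X (x i) powr p)" for i
    unfolding normalized_component_def
    using scaled_mem_state_space_iff[OF component_mem[OF G] lp_mem[OF xL] x_nz,
        of "nrm X (x i) powr (p - 1)" i i] a[of i] p_gt_1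
    by (simp add: powr_minus_one_mult del: of_real_mult)
  show ?thesis
    unfolding iff
  proof
    assume "G \<in> state_space (lp p X) x"
    then show "\<forall>i. nrm (dual X) (component X i G) = nrm X (x i) powr (p - 1) \<and>
        component X i G (x i) = of_real (nrm X (x i) powr p)"
      using component_of_state[OF x x_nz] by blast
  next
    assume R: "\<forall>i. nrm (dual X) (component X i G) = nrm X (x i) powr (p - 1) \<and>
        component X i G (x i) = of_real (nrm X (x i) powr p)"
    have "(\<lambda>i. of_real (nrm X (x i) powr p)) sums (of_real 1 :: 'k)"
      using lp_sums[OF xL] nx by (intro sums_of_real) simp
    then have Gx: "G x = 1"
      using sums_unique2[OF dual_lp_sums[OF G xL]] R by simp
    have "nrm (dual (lp p X)) G \<le> 1"
    proof (rule L.dual_nrm_le)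
      fix y assume y: "y \<in> vecs (lp p X)" "nrm (lp p X) y \<le> 1"
      have le: "norm (component X i G (y i))
          \<le> (1 - 1 / p) * nrm X (x i) powr p + nrm X (y i) powr p / p" for i
        using dual_bound[OF component_mem[OF G] lp_mem[OF y(1)], of i i] R
          Young_powr[OF p_gt_1, of "nrm X (x i)" "nrm X (y i)"] nrm_nonneg[OF lp_mem[OF y(1)], of i]
          a[of i] by simp
      have sums: "(\<lambda>i. (1 - 1 / p) * nrm X (x i) powr p + nrm X (y i) powr p / p) sums
          ((1 - 1 / p) * 1 + nrm (lp p X) y powr p / p)"
        using lp_sums[OF xL] nx by (intro sums_add sums_mult sums_divide lp_sums y) simp
      have "norm (G y) \<le> (1 - 1 / p) * 1 + nrm (lp p X) y powr p / p"
        by (rule norm_limit_sums_le[OF dual_lp_sums[OF G y(1)] sums le])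
      also have "\<dots> \<le> (1 - 1 / p) * 1 + 1 powr p / p"
        using y p_gt_1 nrm_lp_nonneg[of y] by (intro add_mono divide_right_mono powr_mono2) auto
      finally show "norm (G y) \<le> 1" by simp
    qed
    moreover have "1 \<le> nrm (dual (lp p X)) G"
      using L.dual_le_nrm[OF G xL] nx Gx by simp
    ultimately show "G \<in> state_space (lp p X) x"
      using G Gx by (simp add: state_space_def unit_sphere_def)
  qed
qed

section \<open>Points of weak-star to norm continuity\<close>

text \<open>
  The product description of the states turns a state of a single coordinate into a state of \<open>x\<close> by
  substitution into \<open>F\<close>, which gives the forward direction. For the backward direction, all states of
  \<open>x\<close> have the same coordinate norms, so they differ from \<open>F\<close> essentially in finitely many coordinates.
\<close>

proposition lp_wstar_continuous_at_iff:
  assumes x: "x \<in> unit_sphere (lp p X)" and x_nz: "\<And>i. x i \<noteq> 0"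
    and F: "F \<in> state_space (lp p X) x"
  shows "topcontinuous_at
      (subtopology (weak_star (lp p X)) (state_space (lp p X) x))
      (subtopology (norm_topology (dual (lp p X))) (state_space (lp p X) x))
      (\<lambda>g. g) F \<longleftrightarrow>
    (\<forall>i. wstar_norm_PC X (state_space X (normed_vec X (x i))) (normalized_component p X x i F))"
    (is "?L \<longleftrightarrow> ?R")
proof -
  interpret L: normed_space "lp p X" by (rule normed_space_lp)
  interpret D: normed_space "dual X" by (rule normed_space_dual)
  interpret DL: normed_space "dual (lp p X)" by (rule L.normed_space_dual)
  define S where "S i = state_space X (normed_vec X (x i))" for i
  define c where "c i = nrm X (x i) powr (p - 1)" for i
  define N where "N i = normalized_component p X x i" for i
  have xL: "x \<in> vecs (lp p X)" and nx: "nrm (lp p X) x = 1"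
    using x by (auto simp: unit_sphere_def)
  have FL: "F \<in> vecs (dual (lp p X))" using F L.state_space_subset_dual by blast
  have a: "0 < nrm X (x i)" "nrm X (x i) \<le> 1" for i
    using nrm_pos[OF lp_mem[OF xL] x_nz] nrm_coordinate_le[OF xL] nx by auto
  have c: "0 < c i" "c i \<le> 1" for i
    using a[of i] p_gt_1 powr_mono2[of "p - 1" "nrm X (x i)" 1] by (auto simp: c_def)
  have S_sub: "S i \<subseteq> vecs (dual X)" for i
    unfolding S_def by (rule state_space_subset_dual)
  have state_iff: "G \<in> state_space (lp p X) x \<longleftrightarrow> (\<forall>i. N i G \<in> S i)" if "G \<in> vecs (dual (lp p X))" for G
    unfolding N_def S_def by (rule state_space_lp_iff[OF x x_nz that])
  have NF: "N i F \<in> S i" for i using state_iff[OF FL] F by blast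
  have component_eq: "component X i G = scl (dual X) (of_real (c i)) (N i G)" for i G
    using c(1)[of i] by (simp add: N_def normalized_component_def scl_dual c_def)
  have L_iff: "?L \<longleftrightarrow> (\<forall>e>0. \<exists>U. openin (weak_star (lp p X)) U \<and> F \<in> U \<and>
      (\<forall>G\<in>U \<inter> state_space (lp p X) x. nrm (dual (lp p X)) (G - F) < e))"
    by (rule L.wstar_norm_continuous_at_iff[OF L.state_space_subset_dual F])
  have R_iff: "wstar_norm_PC X (S i) (N i F) \<longleftrightarrow> (\<forall>e>0. \<exists>U. openin (weak_star X) U \<and> N i F \<in> U \<and>
      (\<forall>h\<in>U \<inter> S i. nrm (dual X) (h - N i F) < e))" for i
    using wstar_norm_continuous_at_iff[OF S_sub NF] NF[of i] by (simp add: wstar_norm_PC_def)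
  have "?L \<longleftrightarrow> (\<forall>i. wstar_norm_PC X (S i) (N i F))"
    unfolding L_iff R_iff
  proof (intro iffI allI impI)
    fix i and e :: real
    assume "0 < e" and "\<forall>e>0. \<exists>U. openin (weak_star (lp p X)) U \<and> F \<in> U \<and>
      (\<forall>G\<in>U \<inter> state_space (lp p X) x. nrm (dual (lp p X)) (G - F) < e)"
    moreover have "0 < c i * e" using \<open>0 < e\<close> c by simp
    ultimately obtain U where U: "openin (weak_star (lp p X)) U" "F \<in> U"
      and U_small: "\<And>G. G \<in> U \<Longrightarrow> G \<in> state_space (lp p X) x \<Longrightarrow> nrm (dual (lp p X)) (G - F) < c i * e"
      by (metis IntI)
    \<comment> \<open>\<open>\<Phi> h\<close> is \<open>F\<close> with its \<open>i\<close>-th component replaced by \<open>c\<^sub>i h\<close>.\<close>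
    define \<Phi> where "\<Phi> h = F + at_coordinate p X i (scl (dual X) (of_real (c i)) h - component X i F)" for h
    have scaled: "scl (dual X) (of_real (c i)) h - component X i F \<in> vecs (dual X)"
      if "h \<in> vecs (dual X)" for h
      by (intro D.diff_mem D.scl_mem that component_mem FL)
    have \<Phi>_mem: "\<Phi> h \<in> vecs (dual (lp p X))" if "h \<in> vecs (dual X)" for h
      unfolding \<Phi>_def by (intro DL.add_mem FL at_coordinate_mem scaled that)
    have \<Phi>_component: "component X j (\<Phi> h) =
        (if j = i then scl (dual X) (of_real (c i)) h else component X j F)"
      if "h \<in> vecs (dual X)" for h j
      unfolding \<Phi>_def component_add component_at_coordinate[OF scaled[OF that]] by auto
    have \<Phi>_N: "N j (\<Phi> h) = (if j = i then h else N j F)" if "h \<in> vecs (dual X)" for h j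
      using c(1)[of i] by (simp add: N_def normalized_component_def \<Phi>_component[OF that] scl_dual c_def)
    have "\<Phi> (N i F) = F"
      by (simp add: \<Phi>_def flip: component_eq) (simp add: at_coordinate_def fun_eq_iff)
    have "continuous_map (weak_star X) (weak_star (lp p X)) \<Phi>"
    proof (rule L.continuous_map_into_weak_star)
      fix y assume y: "y \<in> vecs (lp p X)"
      have "continuous_map euclidean euclidean (\<lambda>t. F y + (of_real (c i) * t - component X i F (y i)))"
        by (auto intro!: continuous_intros)
      from continuous_map_compose[OF continuous_map_weak_star_eval[OF lp_mem[OF y]] this]
      show "continuous_map (weak_star X) euclidean (\<lambda>h. \<Phi> h y)"
        using y by (simp add: o_def \<Phi>_def at_coordinate_def scl_dual)
    qed (simp add: topspace_weak_star \<Phi>_mem)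
    then have V: "openin (weak_star X) {h \<in> vecs (dual X). \<Phi> h \<in> U}" (is "openin _ ?V")
      using openin_continuous_map_preimage[of "weak_star X" "weak_star (lp p X)" \<Phi>, OF _ U(1)]
      by (simp add: topspace_weak_star)
    have "nrm (dual X) (h - N i F) < e" if h: "h \<in> ?V \<inter> S i" for h
    proof -
      have hX: "h \<in> vecs (dual X)" and \<Phi>U: "\<Phi> h \<in> U" using h by auto
      have "\<Phi> h \<in> state_space (lp p X) x"
        unfolding state_iff[OF \<Phi>_mem[OF hX]] using \<Phi>_N[OF hX] h NF by auto
      then have small: "nrm (dual (lp p X)) (\<Phi> h - F) < c i * e" by (rule U_small[OF \<Phi>U])
      have hN: "h - N i F \<in> vecs (dual X)" using hX NF S_sub by (blast intro: D.diff_mem)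
      have "component X i (\<Phi> h - F) = scl (dual X) (of_real (c i)) (h - N i F)"
        unfolding component_diff \<Phi>_component[OF hX] component_eq[of i F]
        by (simp add: scl_dual fun_eq_iff algebra_simps)
      then have "c i * nrm (dual X) (h - N i F) = nrm (dual X) (component X i (\<Phi> h - F))"
        using c(1)[of i] by (simp add: D.nrm_scl[OF hN])
      also have "\<dots> \<le> nrm (dual (lp p X)) (\<Phi> h - F)"
        by (intro nrm_component_le DL.diff_mem \<Phi>_mem hX FL)
      also note small
      finally show ?thesis using c(1)[of i] by simp
    qed
    moreover have "N i F \<in> ?V" using NF S_sub U(2) \<open>\<Phi> (N i F) = F\<close> by auto
    ultimately show "\<exists>U. openin (weak_star X) U \<and> N i F \<in> U \<and>
      (\<forall>h\<in>U \<inter> S i. nrm (dual X) (h - N i F) < e)"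
      using V by blast
  next
    fix e :: real
    assume "0 < e" and R: "\<forall>i. \<forall>e>0. \<exists>U. openin (weak_star X) U \<and> N i F \<in> U \<and>
      (\<forall>h\<in>U \<inter> S i. nrm (dual X) (h - N i F) < e)"
    \<comment> \<open>The tail beyond \<open>n\<close> will contribute \<open>4 \<eta> = e / 2\<close> and the first \<open>n\<close> coordinates \<open>n \<delta> \<le> e / 4\<close>.\<close>
    define \<eta> where "\<eta> = e / 8"
    have "0 < \<eta>" using \<open>0 < e\<close> by (simp add: \<eta>_def)
    then obtain s where s: "0 < s"
      "\<And>a b. 0 \<le> a \<Longrightarrow> 0 \<le> b \<Longrightarrow> a powr (p - 1) * b \<le> s * a powr p + \<eta> * b powr p"
      using Young_powr_eps[OF p_gt_1] by blast
    have "0 < \<eta> / s" using \<open>0 < \<eta>\<close> s by simp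
    from suminf_exist_split[OF this lp_summable[OF xL]]
    obtain n where n: "norm (\<Sum>i. nrm X (x (i + n)) powr p) < \<eta> / s" by blast
    define \<delta> where "\<delta> = e / (4 * (real n + 1))"
    have "0 < \<delta>" using \<open>0 < e\<close> by (simp add: \<delta>_def)
    then have "\<forall>i. \<exists>V. openin (weak_star X) V \<and> N i F \<in> V \<and> (\<forall>h\<in>V \<inter> S i. nrm (dual X) (h - N i F) < \<delta>)"
      using R by blast
    from choice[OF this] obtain V where V: "\<And>i. openin (weak_star X) (V i)" "\<And>i. N i F \<in> V i"
      "\<And>i h. h \<in> V i \<Longrightarrow> h \<in> S i \<Longrightarrow> nrm (dual X) (h - N i F) < \<delta>"
      by blast
    have N_mem: "N i G \<in> vecs (dual X)" if "G \<in> vecs (dual (lp p X))" for i G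
      unfolding N_def normalized_component_def by (intro D.scl_mem component_mem that)
    have N_cont: "continuous_map (weak_star (lp p X)) (weak_star X) (N i)" for i
    proof (rule continuous_map_into_weak_star)
      fix z assume z: "z \<in> vecs X"
      have "continuous_map euclidean euclidean (\<lambda>t::'k. of_real (1 / c i) * t)"
        unfolding continuous_map_iff_continuous2 by (intro continuous_on_mult_left continuous_on_id)
      from continuous_map_compose[OF L.continuous_map_weak_star_eval[OF single_mem[OF z]] this]
      show "continuous_map (weak_star (lp p X)) euclidean (\<lambda>G. N i G z)"
        using z by (simp add: o_def N_def normalized_component_def component_def scl_dual c_def)
    qed (simp add: L.topspace_weak_star N_mem)
    \<comment> \<open>Inserting the whole dual keeps the intersection inside it in the case \<open>n = 0\<close>.\<close>
    define U where "U = \<Inter> (insert (vecs (dual (lp p X)))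
      ((\<lambda>i. {G \<in> vecs (dual (lp p X)). N i G \<in> V i}) ` {..<n}))"
    have "openin (weak_star (lp p X)) {G \<in> vecs (dual (lp p X)). N i G \<in> V i}" for i
      using openin_continuous_map_preimage[OF N_cont V(1)] by (simp add: L.topspace_weak_star)
    moreover have "openin (weak_star (lp p X)) (vecs (dual (lp p X)))"
      using openin_topspace[of "weak_star (lp p X)"] by (simp add: L.topspace_weak_star)
    ultimately have "openin (weak_star (lp p X)) U"
      unfolding U_def by (intro openin_Inter) auto
    moreover have "F \<in> U" using FL V(2) by (auto simp: U_def)
    moreover have "nrm (dual (lp p X)) (G - F) < e" if G: "G \<in> U \<inter> state_space (lp p X) x" for G
    proof -
      have GL: "G \<in> vecs (dual (lp p X))" and G_V: "\<And>i. i < n \<Longrightarrow> N i G \<in> V i"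
        using G by (auto simp: U_def)
      have GS: "N i G \<in> S i" for i using state_iff[OF GL] G by blast
      have GF: "G - F \<in> vecs (dual (lp p X))" by (rule DL.diff_mem[OF GL FL])
      have head: "nrm (dual X) (component X i (G - F)) \<le> \<delta>" if "i < n" for i
      proof -
        have NN: "N i G - N i F \<in> vecs (dual X)" by (intro D.diff_mem N_mem GL FL)
        have "component X i (G - F) = scl (dual X) (of_real (c i)) (N i G - N i F)"
          unfolding component_diff component_eq by (simp add: scl_dual fun_eq_iff algebra_simps)
        then have "nrm (dual X) (component X i (G - F)) = c i * nrm (dual X) (N i G - N i F)"
          using c(1)[of i] by (simp add: D.nrm_scl[OF NN])
        also have "\<dots> \<le> 1 * \<delta>"
          using V(3)[OF G_V[OF that] GS] c[of i] D.nrm_nonneg[OF NN] by (intro mult_mono) auto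
        finally show ?thesis by simp
      qed
      have "nrm (dual (lp p X)) (G - F) \<le> 3 * e / 4"
      proof (rule L.dual_nrm_le)
        fix y assume y: "y \<in> vecs (lp p X)" "nrm (lp p X) y \<le> 1"
        define d where "d i = component X i (G - F) (y i)" for i
        have d_sums: "d sums (G - F) y" unfolding d_def by (rule dual_lp_sums[OF GF y(1)])
        have yi: "0 \<le> nrm X (y i)" "nrm X (y i) \<le> 1" for i
          using nrm_nonneg[OF lp_mem[OF y(1)]] nrm_coordinate_le[OF y(1)] y(2)
          by (auto intro: order_trans)
        have d_head: "norm (d i) \<le> \<delta>" if "i < n" for i
        proof -
          have "norm (d i) \<le> nrm (dual X) (component X i (G - F)) * nrm X (y i)"
            unfolding d_def by (intro dual_bound component_mem GF lp_mem y)
          also have "\<dots> \<le> \<delta> * 1" using head[OF that] yi \<open>0 < \<delta>\<close> by (intro mult_mono) auto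
          finally show ?thesis by simp
        qed
        have "norm (\<Sum>i<n. d i) \<le> (\<Sum>i<n. \<delta>)" by (rule sum_norm_le) (simp add: d_head)
        also have "\<dots> \<le> e / 4" using \<open>0 < e\<close> by (simp add: \<delta>_def field_simps)
        finally have first: "norm (\<Sum>i<n. d i) \<le> e / 4" .
        \<comment> \<open>This bound involves \<open>G\<close> only through \<open>\<parallel>G\<^sub>i\<parallel> = c\<^sub>i\<close>, which makes the tail estimate uniform in \<open>G\<close>.\<close>
        have d_tail: "norm (d i) \<le> 2 * (s * nrm X (x i) powr p + \<eta> * nrm X (y i) powr p)" for i
        proof -
          have le: "norm (component X i H (y i)) \<le> c i * nrm X (y i)"
            if "H \<in> state_space (lp p X) x" for H
            using dual_bound[OF component_mem lp_mem[OF y(1)], of H i i] that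
              L.state_space_subset_dual component_of_state(1)[OF x x_nz that, of i]
            by (auto simp: c_def)
          have "norm (d i) \<le> norm (component X i G (y i)) + norm (component X i F (y i))"
            by (simp add: d_def component_diff norm_triangle_ineq4)
          also have "\<dots> \<le> 2 * (c i * nrm X (y i))" using le[OF F] le[of G] G by simp
          also have "\<dots> \<le> 2 * (s * nrm X (x i) powr p + \<eta> * nrm X (y i) powr p)"
            using s(2)[of "nrm X (x i)" "nrm X (y i)"] a[of i] yi[of i] by (simp add: c_def)
          finally show ?thesis .
        qed
        have xs: "summable (\<lambda>i. nrm X (x (i + n)) powr p)" and ys: "summable (\<lambda>i. nrm X (y (i + n)) powr p)"
          by (intro summable_ignore_initial_segment lp_summable xL y)+
        have d_sums': "(\<lambda>i. d (i + n)) sums ((G - F) y - (\<Sum>i<n. d i))"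
          by (rule sums_split_initial_segment[OF d_sums])
        have "norm ((G - F) y - (\<Sum>i<n. d i)) \<le>
            2 * (s * (\<Sum>i. nrm X (x (i + n)) powr p) + \<eta> * (\<Sum>i. nrm X (y (i + n)) powr p))"
          by (rule norm_limit_sums_le[OF d_sums' _ d_tail])
            (intro sums_mult sums_add summable_sums xs ys)
        also have "\<dots> \<le> 2 * (s * (\<eta> / s) + \<eta> * 1)"
        proof (intro mult_left_mono add_mono)
          show "(\<Sum>i. nrm X (x (i + n)) powr p) \<le> \<eta> / s" using n by simp
          have "(\<Sum>i. nrm X (y (i + n)) powr p) \<le> (\<Sum>i. nrm X (y i) powr p)"
            using suminf_split_initial_segment[OF lp_summable[OF y(1)], of n]
              sum_nonneg[of "{..<n}" "\<lambda>i. nrm X (y i) powr p"] by simp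
          also have "\<dots> = nrm (lp p X) y powr p" using lp_sums[OF y(1)] by (simp add: sums_iff)
          also have "\<dots> \<le> 1 powr p"
            using y(2) p_gt_1 nrm_lp_nonneg by (intro powr_mono2) auto
          finally show "(\<Sum>i. nrm X (y (i + n)) powr p) \<le> 1" by simp
        qed (use s \<open>0 < \<eta>\<close> in auto)
        also have "\<dots> = e / 2" using s(1) by (simp add: \<eta>_def)
        finally have second: "norm ((G - F) y - (\<Sum>i<n. d i)) \<le> e / 2" .
        show "norm ((G - F) y) \<le> 3 * e / 4"
          using norm_triangle_sub[of "(G - F) y" "\<Sum>i<n. d i"] first second by simp
      qed
      then show ?thesis using \<open>0 < e\<close> by simp
    qed
    ultimately show "\<exists>U. openin (weak_star (lp p X)) U \<and> F \<in> U \<and>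
      (\<forall>G\<in>U \<inter> state_space (lp p X) x. nrm (dual (lp p X)) (G - F) < e)"
      by blast
  qed
  then show ?thesis by (simp add: S_def N_def)
qed

lemma component_lp_functional:
  assumes "\<And>j. f j \<in> vecs (dual X)"
  shows "component X i (lp_functional p X f) = f i"
proof
  fix z
  show "component X i (lp_functional p X f) z = f i z"
  proof (cases "z \<in> vecs X")
    case True
    have "(\<lambda>j. f j (single i z j)) = (\<lambda>j. if j = i then f j z else 0)"
      by (auto simp: single_def fun_eq_iff dual_zero[OF assms])
    then have "(\<Sum>j. f j (single i z j)) = f i z"
      using sums_single[of i "\<lambda>j. f j z"] by (simp add: sums_iff)
    then show ?thesis using True by (simp add: component_def lp_functional_def single_mem)
  next
    case False
    then show ?thesis by (simp add: component_def dual_off[OF assms])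
  qed
qed

end

theorem theorem2p8:
  fixes X :: "('k::real_or_complex, 'x::ab_group_add) nspace"
    and p q :: real
    and x :: "nat \<Rightarrow> 'x"
    and f :: "nat \<Rightarrow> 'x \<Rightarrow> 'k"
  assumes "banach_space X"
    and "1 < p" and "1 / p + 1 / q = 1"
    and "x \<in> unit_sphere (lp p X)" and "\<forall>i. x i \<noteq> 0"
    and "f \<in> vecs (lp q (dual X))"
    and "lp_functional p X f \<in> state_space (lp p X) x"
  shows "(\<forall>i. normed_vec (dual X) (f i) \<in> state_space X (normed_vec X (x i))) \<and>
    (topcontinuous_at
        (subtopology (weak_star (lp p X)) (state_space (lp p X) x))
        (subtopology (norm_topology (dual (lp p X))) (state_space (lp p X) x))
        (\<lambda>g. g) (lp_functional p X f)
      \<longleftrightarrow> (\<forall>i. wstar_norm_PC X (state_space X (normed_vec X (x i))) (normed_vec (dual X) (f i))))"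
proof -
  interpret lp_space X p
    using assms(1,2) by (simp add: lp_space_def lp_space_axioms_def banach_space_def)
  interpret L: normed_space "lp p X" by (rule normed_space_lp)
  have x_nz: "\<And>i. x i \<noteq> 0" using assms(5) by blast
  have f: "f i \<in> vecs (dual X)" for i using assms(6) by (simp add: lp_def)
  have f_norm: "nrm (dual X) (f i) = nrm X (x i) powr (p - 1)" for i
    using component_of_state(1)[OF assms(4) x_nz assms(7), of i] by (simp add: component_lp_functional f)
  have eq: "normalized_component p X x i (lp_functional p X f) = normed_vec (dual X) (f i)" for i
    by (simp add: normalized_component_def normed_vec_def component_lp_functional f f_norm)
  have "lp_functional p X f \<in> vecs (dual (lp p X))"
    using assms(7) L.state_space_subset_dual by blast
  then show ?thesis
    using state_space_lp_iff[OF assms(4) x_nz] lp_wstar_continuous_at_iff[OF assms(4) x_nz assms(7)]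
      assms(7) by (simp add: eq)
qed

end
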